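(* Let $\lambda_1,\lambda_2,\lambda_3\in\mathbb{R}$ and let $\mathbb{K}$ be the associated algebra of 3-parameter generalized quaternions. Then $S_{\mathbb{K}}=\{p\in\mathbb{K}:N_p=1\}$, with the multiplication of $\mathbb{K}$, is a 3-dimensional Lie group.
   Context: Given $\lambda_1,\lambda_2,\lambda_3\in\mathbb{R}$, $\mathbb{K}$ is the (associative, unital) real algebra with vector-space basis $1,e_1,e_2,e_3$, unit $1$, and bilinear multiplication determined by $e_1^2=-\lambda_1\lambda_2$, $e_2^2=-\lambda_1\lambda_3$, $e_3^2=-\lambda_2\lambda_3$, $e_1e_2=\lambda_1e_3=-e_2e_1$, $e_2e_3=\lambda_3e_1=-e_3e_2$, $e_3e_1=\lambda_2e_2=-e_1e_3$. For $p=a_0+a_1e_1+a_2e_2+a_3e_3\in\mathbb{K}$ (with $a_i\in\mathbb{R}$), the norm is $N_p=a_0^2+\lambda_1\lambda_2a_1^2+\lambda_1\lambda_3a_2^2+\lambda_2\lambda_3a_3^2$. The smooth structure on $S_{\mathbb{K}}$ is that of an embedded submanifold of $\mathbb{K}\cong\mathbb{R}^4$. *)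

theory Defs
  imports "HOL-Analysis.Analysis" "HOL-Algebra.Group"
begin

section \<open>Smooth maps between Euclidean spaces\<close>

text \<open>The derivatives \<open>frechet_derivative f (at x)\<close> are two-sided, so these notions are meant for,
  and only used with, open sets \<open>S\<close>.\<close>

primrec higher_differentiable_on ::
  "'a::real_normed_vector set \<Rightarrow> ('a \<Rightarrow> 'b::real_normed_vector) \<Rightarrow> nat \<Rightarrow> bool" where
  "higher_differentiable_on S f 0 \<longleftrightarrow> continuous_on S f"
| "higher_differentiable_on S f (Suc n) \<longleftrightarrow>
     (\<forall>x\<in>S. f differentiable (at x)) \<and>
     (\<forall>v. higher_differentiable_on S (\<lambda>x. frechet_derivative f (at x) v) n)"

definition smooth_on ::
  "'a::real_normed_vector set \<Rightarrow> ('a \<Rightarrow> 'b::real_normed_vector) \<Rightarrow> bool" where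
  "smooth_on S f \<longleftrightarrow> (\<forall>n. higher_differentiable_on S f n)"

definition diffeomorphism_on ::
  "'a::real_normed_vector set \<Rightarrow> ('a \<Rightarrow> 'b::real_normed_vector) \<Rightarrow> bool" where
  "diffeomorphism_on W \<Phi> \<longleftrightarrow>
     open W \<and> open (\<Phi> ` W) \<and> inj_on \<Phi> W \<and>
     smooth_on W \<Phi> \<and> smooth_on (\<Phi> ` W) (inv_into W \<Phi>)"


section \<open>Smooth manifolds\<close>

text \<open>A chart is a pair \<open>(U, \<phi>)\<close>; the values of \<open>\<phi>\<close> outside \<open>U\<close> are irrelevant.  The dimension of
  a manifold is that of the model space \<open>'b\<close>.\<close>

type_synonym ('a, 'b) chart = "'a set \<times> ('a \<Rightarrow> 'b)"

definition is_chart :: "'a topology \<Rightarrow> ('a, 'b::euclidean_space) chart \<Rightarrow> bool" where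
  "is_chart X = (\<lambda>(U, \<phi>). openin X U \<and> open (\<phi> ` U) \<and>
     homeomorphic_map (subtopology X U) (top_of_set (\<phi> ` U)) \<phi>)"

definition smooth_map ::
  "'a topology \<Rightarrow> ('a, 'b::euclidean_space) chart set \<Rightarrow>
   'c topology \<Rightarrow> ('c, 'd::euclidean_space) chart set \<Rightarrow> ('a \<Rightarrow> 'c) \<Rightarrow> bool" where
  "smooth_map X A Y B f \<longleftrightarrow> continuous_map X Y f \<and>
     (\<forall>(U, \<phi>)\<in>A. \<forall>(V, \<psi>)\<in>B. smooth_on (\<phi> ` (U \<inter> f -` V)) (\<psi> \<circ> f \<circ> inv_into U \<phi>))"

locale smooth_manifold =
  fixes X :: "'a topology" and A :: "('a, 'b::euclidean_space) chart set"
  assumes Hausdorff: "Hausdorff_space X"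
    and second_countable: "second_countable X"
    and charts: "\<And>c. c \<in> A \<Longrightarrow> is_chart X c"
    and charts_cover: "topspace X = (\<Union>(U, \<phi>)\<in>A. U)"
    and charts_compatible: "\<And>U \<phi> V \<psi>. (U, \<phi>) \<in> A \<Longrightarrow> (V, \<psi>) \<in> A \<Longrightarrow>
          smooth_on (\<phi> ` (U \<inter> V)) (\<psi> \<circ> inv_into U \<phi>)"

definition prod_atlas ::
  "('a, 'b) chart set \<Rightarrow> ('c, 'd) chart set \<Rightarrow> ('a \<times> 'c, 'b \<times> 'd) chart set" where
  "prod_atlas A B = {(U \<times> V, map_prod \<phi> \<psi>) | U \<phi> V \<psi>. (U, \<phi>) \<in> A \<and> (V, \<psi>) \<in> B}"


section \<open>Embedded submanifolds of Euclidean spaces\<close>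

text \<open>Slice charts of \<open>S\<close>: local diffeomorphisms of the ambient space that flatten \<open>S\<close> to
  \<open>'b \<times> {0}\<close>.  Their first components, restricted to \<open>S\<close>, form the atlas of the submanifold
  structure of \<open>S\<close>; \<open>S\<close> is an embedded submanifold iff this atlas covers \<open>S\<close>.
  The type argument is the space of normal coordinates.\<close>

definition slice_chart ::
  "'a::euclidean_space set \<Rightarrow> 'a set \<Rightarrow> ('a \<Rightarrow> 'b::euclidean_space \<times> 'c::euclidean_space) \<Rightarrow> bool" where
  "slice_chart S W \<Phi> \<longleftrightarrow>
     diffeomorphism_on W \<Phi> \<and> \<Phi> ` (W \<inter> S) = \<Phi> ` W \<inter> (UNIV \<times> {0})"

definition submanifold_atlas ::
  "'c::euclidean_space itself \<Rightarrow> 'a::euclidean_space set \<Rightarrow> ('a, 'b::euclidean_space) chart set" where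
  "submanifold_atlas _ S =
     {(W \<inter> S, fst \<circ> \<Phi>) | W (\<Phi> :: 'a \<Rightarrow> 'b \<times> 'c). slice_chart S W \<Phi>}"


section \<open>Lie groups\<close>

locale lie_group = group G + smooth_manifold X A
  for G :: "('a, 'm) monoid_scheme" (structure)
    and X :: "'a topology" and A :: "('a, 'b::euclidean_space) chart set" +
  assumes topspace_eq_carrier: "topspace X = carrier G"
    and smooth_mult:
      "smooth_map (prod_topology X X) (prod_atlas A A) X A (\<lambda>(x, y). x \<otimes> y)"
    and smooth_inv: "smooth_map X A X A (\<lambda>x. inv x)"


section \<open>3-parameter generalized quaternions\<close>

text \<open>The underlying space is \<open>real^4\<close>, with coordinates indexed by \<open>0, 1, 2, 3 :: 4\<close> (in this
  index type \<open>4 = 0\<close>).  The unit is \<open>gq_e 0\<close>; note that \<open>1 :: real^4\<close> is a different vector.\<close>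

definition gq_e :: "4 \<Rightarrow> real^4" where
  "gq_e i = axis i 1"

definition gq_table :: "real \<Rightarrow> real \<Rightarrow> real \<Rightarrow> 4 \<Rightarrow> 4 \<Rightarrow> real^4" where
  "gq_table l1 l2 l3 i j =
    (if i = 0 then gq_e j
     else if j = 0 then gq_e i
     else if (i, j) = (1, 1) then - (l1 * l2) *\<^sub>R gq_e 0
     else if (i, j) = (2, 2) then - (l1 * l3) *\<^sub>R gq_e 0
     else if (i, j) = (3, 3) then - (l2 * l3) *\<^sub>R gq_e 0
     else if (i, j) = (1, 2) then l1 *\<^sub>R gq_e 3
     else if (i, j) = (2, 1) then - l1 *\<^sub>R gq_e 3
     else if (i, j) = (2, 3) then l3 *\<^sub>R gq_e 1
     else if (i, j) = (3, 2) then - l3 *\<^sub>R gq_e 1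
     else if (i, j) = (3, 1) then l2 *\<^sub>R gq_e 2
     else - l2 *\<^sub>R gq_e 2)"

definition gq_mult :: "real \<Rightarrow> real \<Rightarrow> real \<Rightarrow> real^4 \<Rightarrow> real^4 \<Rightarrow> real^4" where
  "gq_mult l1 l2 l3 p q = (\<Sum>i\<in>UNIV. \<Sum>j\<in>UNIV. (p $ i * q $ j) *\<^sub>R gq_table l1 l2 l3 i j)"

definition gq_norm :: "real \<Rightarrow> real \<Rightarrow> real \<Rightarrow> real^4 \<Rightarrow> real" where
  "gq_norm l1 l2 l3 p =
     (p $ 0)\<^sup>2 + l1 * l2 * (p $ 1)\<^sup>2 + l1 * l3 * (p $ 2)\<^sup>2 + l2 * l3 * (p $ 3)\<^sup>2"

definition gq_sphere :: "real \<Rightarrow> real \<Rightarrow> real \<Rightarrow> (real^4) set" where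
  "gq_sphere l1 l2 l3 = {p. gq_norm l1 l2 l3 p = 1}"

definition gq_sphere_monoid :: "real \<Rightarrow> real \<Rightarrow> real \<Rightarrow> (real^4) monoid" where
  "gq_sphere_monoid l1 l2 l3 =
     \<lparr>carrier = gq_sphere l1 l2 l3, mult = gq_mult l1 l2 l3, one = gq_e 0\<rparr>"

text \<open>Sanity checks: the multiplication in coordinates, and the algebra axioms.\<close>

lemma forall_4_from_0: "(\<forall>i::4. P i) \<longleftrightarrow> P 0 \<and> P 1 \<and> P 2 \<and> P 3"
proof -
  have "(4::4) = 0" by simp
  then show ?thesis unfolding forall_4 by metis
qed

lemma sum_4_from_0: "sum f (UNIV :: 4 set) = f 0 + f 1 + f 2 + (f 3 :: 'a::comm_monoid_add)"
proof -
  have "(4::4) = 0" by simp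
  then have "f 4 = f 0" by metis
  then show ?thesis unfolding sum_4 by (simp add: ac_simps)
qed

lemma gq_mult_nth:
  "gq_mult l1 l2 l3 p q $ 0 =
     p$0 * q$0 - l1 * l2 * (p$1 * q$1) - l1 * l3 * (p$2 * q$2) - l2 * l3 * (p$3 * q$3)"
  "gq_mult l1 l2 l3 p q $ 1 = p$0 * q$1 + p$1 * q$0 + l3 * (p$2 * q$3 - p$3 * q$2)"
  "gq_mult l1 l2 l3 p q $ 2 = p$0 * q$2 + p$2 * q$0 + l2 * (p$3 * q$1 - p$1 * q$3)"
  "gq_mult l1 l2 l3 p q $ 3 = p$0 * q$3 + p$3 * q$0 + l1 * (p$1 * q$2 - p$2 * q$1)"
  by (simp_all add: gq_mult_def sum_4_from_0 gq_table_def gq_e_def axis_def algebra_simps)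

lemma gq_mult_e: "gq_mult l1 l2 l3 (gq_e i) (gq_e j) = gq_table l1 l2 l3 i j"
proof -
  have "(gq_e i $ k * gq_e j $ m) *\<^sub>R gq_table l1 l2 l3 k m =
      (if m = j then if k = i then gq_table l1 l2 l3 k m else 0 else 0)" for k m
    by (simp add: gq_e_def axis_def)
  then show ?thesis by (simp add: gq_mult_def)
qed

lemma bilinear_gq_mult: "bilinear (gq_mult l1 l2 l3)"
  by (auto simp: bilinear_def vec_eq_iff forall_4_from_0 gq_mult_nth algebra_simps intro!: linearI)

lemma gq_mult_assoc:
  "gq_mult l1 l2 l3 (gq_mult l1 l2 l3 p q) r = gq_mult l1 l2 l3 p (gq_mult l1 l2 l3 q r)"
  by (simp add: vec_eq_iff forall_4_from_0 gq_mult_nth algebra_simps)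

lemma gq_mult_unit: "gq_mult l1 l2 l3 (gq_e 0) p = p" "gq_mult l1 l2 l3 p (gq_e 0) = p"
  by (simp_all add: vec_eq_iff forall_4_from_0 gq_mult_nth gq_e_def axis_def)

lemma gq_norm_mult:
  "gq_norm l1 l2 l3 (gq_mult l1 l2 l3 p q) = gq_norm l1 l2 l3 p * gq_norm l1 l2 l3 q"
  by (simp add: gq_norm_def gq_mult_nth algebra_simps power2_eq_square)

end

theory Submission
  imports Defs
begin

text \<open>
  The norm is multiplicative and \<open>p\<close> times its conjugate is the norm of \<open>p\<close> times the unit, so the
  quaternions of norm one are closed under multiplication and have their conjugates as inverses.
  Multiplication is bilinear and conjugation is linear, so both operations are restrictions of
  smooth maps of the ambient space.  The two remaining points are that the norm-one set is an
  embedded hypersurface and that restrictions of smooth ambient maps are smooth in the charts of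
  embedded submanifolds.

  For the first point, the real part is positive near the unit, hence it is the square root
  of the norm minus the quadratic form of the imaginary part; this inverts the map (imaginary part, norm minus one) explicitly and smoothly
  (\<open>slice_chart_gq_unit\<close>).  Left multiplication by an element \<open>p\<close> of norm one is a linear
  automorphism of the ambient space that preserves the norm and takes the unit to \<open>p\<close>, and
  therefore carries this slice chart to one around \<open>p\<close> (\<open>slice_chart_linear_image\<close>).  This argument
  is uniform in the signs of the parameters, so indefinite and degenerate norms are covered as well.

  For the second point, the inverse of a slice chart, restricted to the slice, is smooth as a map
  into the ambient space.  The coordinate expression of a restricted ambient map is thus a composite
  of smooth maps between open sets (\<open>smooth_on_coordinates\<close>).  Products of charts have the same
  property, which handles the multiplication; and the identity map gives the compatibility of the
  charts.  The rules for sums, products and composites of smooth maps are proved by induction on the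
  order of differentiability.
\<close>

section \<open>Calculus of higher differentiability\<close>

lemma frechet_derivative_eq:
  "(f has_derivative f') (at x) \<Longrightarrow> frechet_derivative f (at x) = f'"
  by (metis frechet_derivative_at)

lemma higher_differentiable_on_cong:
  assumes "open S" "\<And>x. x \<in> S \<Longrightarrow> f x = g x" "higher_differentiable_on S f n"
  shows "higher_differentiable_on S g n"
  using assms
proof (induction n arbitrary: f g)
  case 0
  then show ?case by (simp cong: continuous_on_cong)
next
  case (Suc n)
  have D: "(g has_derivative frechet_derivative f (at x)) (at x)" if "x \<in> S" for x
  proof (rule has_derivative_transform_within_open)
    show "(f has_derivative frechet_derivative f (at x)) (at x)"
      using Suc.prems(3) that by (auto simp: frechet_derivative_works[symmetric])
  qed (use Suc.prems that in auto)
  have "higher_differentiable_on S (\<lambda>x. frechet_derivative g (at x) v) n" for v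
  proof (rule Suc.IH[where f = "\<lambda>x. frechet_derivative f (at x) v"])
    show "frechet_derivative f (at x) v = frechet_derivative g (at x) v" if "x \<in> S" for x
      using frechet_derivative_eq[OF D[OF that]] by simp
  qed (use Suc.prems in auto)
  then show ?case using D by (auto simp: differentiable_def)
qed

lemma higher_differentiable_on_subset:
  assumes "higher_differentiable_on T f n" "S \<subseteq> T"
  shows "higher_differentiable_on S f n"
  using assms by (induction n arbitrary: f) (auto intro: continuous_on_subset)

lemma higher_differentiable_on_SucD:
  "higher_differentiable_on S f (Suc n) \<Longrightarrow> higher_differentiable_on S f n"
proof (induction n arbitrary: f)
  case 0
  then show ?case
    by (auto intro!: continuous_at_imp_continuous_on differentiable_imp_continuous_within)
next
  case (Suc n)
  have "higher_differentiable_on S (\<lambda>x. frechet_derivative f (at x) v) n" for v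
    using Suc.prems by (intro Suc.IH) simp
  then show ?case using Suc.prems by simp
qed

text \<open>The induction steps below all have this form: a formula for the derivative, valid on an
  open set, and the knowledge that this formula is differentiable one time less.\<close>

lemma higher_differentiable_on_SucI:
  assumes "open S" "\<And>x. x \<in> S \<Longrightarrow> (f has_derivative f' x) (at x)"
    and "\<And>v. higher_differentiable_on S (\<lambda>x. f' x v) n"
  shows "higher_differentiable_on S f (Suc n)"
proof -
  have "higher_differentiable_on S (\<lambda>x. frechet_derivative f (at x) v) n" for v
    by (rule higher_differentiable_on_cong[OF assms(1) _ assms(3)[of v]])
      (use frechet_derivative_eq[OF assms(2)] in auto)
  then show ?thesis using assms(2) by (auto simp: differentiable_def)
qed

lemma higher_differentiable_on_SucE:
  assumes "higher_differentiable_on S f (Suc n)"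
  obtains f' where "\<And>x. x \<in> S \<Longrightarrow> (f has_derivative f' x) (at x)"
    and "\<And>v. higher_differentiable_on S (\<lambda>x. f' x v) n"
  using assms that[of "\<lambda>x. frechet_derivative f (at x)"]
  by (auto simp: frechet_derivative_works[symmetric])

lemma higher_differentiable_on_const:
  "open S \<Longrightarrow> higher_differentiable_on S (\<lambda>x. c) n"
proof (induction n arbitrary: c)
  case (Suc n)
  show ?case
    by (rule higher_differentiable_on_SucI[where f' = "\<lambda>x v. 0"]) (use Suc in auto)
qed auto

lemma higher_differentiable_on_add:
  assumes "open S" "higher_differentiable_on S f n" "higher_differentiable_on S g n"
  shows "higher_differentiable_on S (\<lambda>x. f x + g x) n"
  using assms
proof (induction n arbitrary: f g)
  case (Suc n)
  obtain f' where f': "\<And>x. x \<in> S \<Longrightarrow> (f has_derivative f' x) (at x)"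
    "\<And>v. higher_differentiable_on S (\<lambda>x. f' x v) n"
    using higher_differentiable_on_SucE[OF Suc.prems(2)] by blast
  obtain g' where g': "\<And>x. x \<in> S \<Longrightarrow> (g has_derivative g' x) (at x)"
    "\<And>v. higher_differentiable_on S (\<lambda>x. g' x v) n"
    using higher_differentiable_on_SucE[OF Suc.prems(3)] by blast
  show ?case
    by (rule higher_differentiable_on_SucI[where f' = "\<lambda>x v. f' x v + g' x v"])
      (use Suc f' g' in \<open>auto intro: has_derivative_add\<close>)
qed (auto intro: continuous_intros)

lemma higher_differentiable_on_sum:
  assumes "open S" "finite I" "\<And>i. i \<in> I \<Longrightarrow> higher_differentiable_on S (f i) n"
  shows "higher_differentiable_on S (\<lambda>x. \<Sum>i\<in>I. f i x) n"
  using assms(2,3)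
  by (induction I rule: finite_induct)
    (auto simp: assms(1) higher_differentiable_on_const higher_differentiable_on_add)

text \<open>By the Leibniz rule the derivative contains both factors again, undifferentiated.  They are
  \<open>n\<close> times differentiable because they are \<open>Suc n\<close> times differentiable, so the induction
  hypothesis applies when it is generalized over both factors.\<close>

lemma higher_differentiable_on_bounded_bilinear:
  assumes "bounded_bilinear m" "open S"
    and "higher_differentiable_on S f n" "higher_differentiable_on S g n"
  shows "higher_differentiable_on S (\<lambda>x. m (f x) (g x)) n"
  using assms(3,4)
proof (induction n arbitrary: f g)
  case 0
  then show ?case by (auto intro: bounded_bilinear.continuous_on[OF assms(1)])
next
  case (Suc n)
  obtain f' where f': "\<And>x. x \<in> S \<Longrightarrow> (f has_derivative f' x) (at x)"
    "\<And>v. higher_differentiable_on S (\<lambda>x. f' x v) n"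
    using higher_differentiable_on_SucE[OF Suc.prems(1)] by blast
  obtain g' where g': "\<And>x. x \<in> S \<Longrightarrow> (g has_derivative g' x) (at x)"
    "\<And>v. higher_differentiable_on S (\<lambda>x. g' x v) n"
    using higher_differentiable_on_SucE[OF Suc.prems(2)] by blast
  show ?case
  proof (rule higher_differentiable_on_SucI[OF assms(2)])
    show "((\<lambda>x. m (f x) (g x)) has_derivative (\<lambda>v. m (f x) (g' x v) + m (f' x v) (g x))) (at x)"
      if "x \<in> S" for x
      using bounded_bilinear.FDERIV[OF assms(1) f'(1)[OF that] g'(1)[OF that]] .
    show "higher_differentiable_on S (\<lambda>x. m (f x) (g' x v) + m (f' x v) (g x)) n" for v
      by (intro higher_differentiable_on_add Suc.IH assms f' g'
          higher_differentiable_on_SucD[OF Suc.prems(1)] higher_differentiable_on_SucD[OF Suc.prems(2)])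
  qed
qed

lemma higher_differentiable_on_bounded_linear:
  assumes "bounded_linear L" "open S"
  shows "higher_differentiable_on S L n"
proof (cases n)
  case 0
  then show ?thesis
    using assms(1) by (simp add: linear_continuous_on)
next
  case (Suc k)
  then show ?thesis
    using higher_differentiable_on_SucI[of S L "\<lambda>x. L" k] assms
    by (simp add: bounded_linear_imp_has_derivative higher_differentiable_on_const)
qed

text \<open>By the chain rule, the derivative of \<open>g \<circ> f\<close> in direction \<open>v\<close> is the derivative of \<open>g\<close> at
  \<open>f x\<close> in a direction that itself varies with \<open>x\<close>.  Expanding that direction in a basis leaves
  only derivatives of \<open>g\<close> in fixed directions, to which the induction hypothesis applies; this is
  where finite dimension of the intermediate space enters.\<close>

lemma higher_differentiable_on_compose:
  fixes f :: "'a::real_normed_vector \<Rightarrow> 'b::euclidean_space"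
    and g :: "'b \<Rightarrow> 'c::real_normed_vector"
  assumes "open S" "open T" "f ` S \<subseteq> T"
    and "higher_differentiable_on S f n" "higher_differentiable_on T g n"
  shows "higher_differentiable_on S (\<lambda>x. g (f x)) n"
  using assms(4,5)
proof (induction n arbitrary: g)
  case 0
  then show ?case using assms(3) by (auto intro: continuous_on_compose2)
next
  case (Suc n)
  obtain f' where f': "\<And>x. x \<in> S \<Longrightarrow> (f has_derivative f' x) (at x)"
    "\<And>v. higher_differentiable_on S (\<lambda>x. f' x v) n"
    using higher_differentiable_on_SucE[OF Suc.prems(1)] by blast
  obtain g' where g': "\<And>y. y \<in> T \<Longrightarrow> (g has_derivative g' y) (at y)"
    "\<And>v. higher_differentiable_on T (\<lambda>y. g' y v) n"
    using higher_differentiable_on_SucE[OF Suc.prems(2)] by blast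
  show ?case
  proof (rule higher_differentiable_on_SucI[OF assms(1)])
    fix x assume "x \<in> S"
    then have gx: "(g has_derivative g' (f x)) (at (f x))" using g'(1) assms(3) by auto
    have "g' (f x) w = (\<Sum>b\<in>Basis. (w \<bullet> b) *\<^sub>R g' (f x) b)" for w
    proof -
      have L: "linear (g' (f x))" using gx by (rule has_derivative_linear)
      have "g' (f x) w = g' (f x) (\<Sum>b\<in>Basis. (w \<bullet> b) *\<^sub>R b)" by (simp add: euclidean_representation)
      also have "\<dots> = (\<Sum>b\<in>Basis. (w \<bullet> b) *\<^sub>R g' (f x) b)"
        by (simp only: linear_sum[OF L] linear_cmul[OF L])
      finally show ?thesis .
    qed
    then show "((\<lambda>x. g (f x)) has_derivative
        (\<lambda>v. \<Sum>b\<in>Basis. (f' x v \<bullet> b) *\<^sub>R g' (f x) b)) (at x)"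
      by (intro has_derivative_eq_rhs[OF has_derivative_compose[OF f'(1)[OF \<open>x \<in> S\<close>] gx]] ext)
  next
    fix v
    show "higher_differentiable_on S (\<lambda>x. \<Sum>b\<in>Basis. (f' x v \<bullet> b) *\<^sub>R g' (f x) b) n"
    proof (intro higher_differentiable_on_sum
        higher_differentiable_on_bounded_bilinear[OF bounded_bilinear_scaleR]
        higher_differentiable_on_bounded_bilinear[OF bounded_bilinear_inner] assms(1) f'
        higher_differentiable_on_const)
      show "higher_differentiable_on S (\<lambda>x. g' (f x) b) n" for b
        using Suc.IH[OF higher_differentiable_on_SucD[OF Suc.prems(1)] g'(2)] .
    qed auto
  qed
qed


section \<open>Smooth maps\<close>

lemma smooth_on_cong:
  "open S \<Longrightarrow> smooth_on S f \<Longrightarrow> (\<And>x. x \<in> S \<Longrightarrow> f x = g x) \<Longrightarrow> smooth_on S g"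
  unfolding smooth_on_def by (metis higher_differentiable_on_cong)

lemma smooth_on_subset: "smooth_on T f \<Longrightarrow> S \<subseteq> T \<Longrightarrow> smooth_on S f"
  unfolding smooth_on_def by (blast intro: higher_differentiable_on_subset)

lemma smooth_on_imp_continuous_on: "smooth_on S f \<Longrightarrow> continuous_on S f"
  unfolding smooth_on_def by (metis higher_differentiable_on.simps(1))

lemma smooth_on_const: "open S \<Longrightarrow> smooth_on S (\<lambda>x. c)"
  unfolding smooth_on_def by (blast intro: higher_differentiable_on_const)

lemma smooth_on_add:
  "open S \<Longrightarrow> smooth_on S f \<Longrightarrow> smooth_on S g \<Longrightarrow> smooth_on S (\<lambda>x. f x + g x)"
  unfolding smooth_on_def by (blast intro: higher_differentiable_on_add)

lemma smooth_on_bounded_bilinear: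
  "bounded_bilinear m \<Longrightarrow> open S \<Longrightarrow> smooth_on S f \<Longrightarrow> smooth_on S g \<Longrightarrow>
    smooth_on S (\<lambda>x. m (f x) (g x))"
  unfolding smooth_on_def by (blast intro: higher_differentiable_on_bounded_bilinear)

lemmas smooth_on_scaleR = smooth_on_bounded_bilinear[OF bounded_bilinear_scaleR]
lemmas smooth_on_mult = smooth_on_bounded_bilinear[OF bounded_bilinear_mult]

lemma smooth_on_compose:
  fixes f :: "'a::real_normed_vector \<Rightarrow> 'b::euclidean_space"
  assumes "open S" "open T" "f ` S \<subseteq> T" "smooth_on S f" "smooth_on T g"
  shows "smooth_on S (\<lambda>x. g (f x))"
  using assms unfolding smooth_on_def by (blast intro: higher_differentiable_on_compose)

lemma smooth_on_linear:
  fixes L :: "'a::euclidean_space \<Rightarrow> 'b::real_normed_vector"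
  shows "linear L \<Longrightarrow> open S \<Longrightarrow> smooth_on S L"
  unfolding smooth_on_def linear_conv_bounded_linear
  by (blast intro: higher_differentiable_on_bounded_linear)

lemma smooth_on_linear_compose:
  fixes L :: "'b::euclidean_space \<Rightarrow> 'c::real_normed_vector"
  shows "linear L \<Longrightarrow> open S \<Longrightarrow> smooth_on S f \<Longrightarrow> smooth_on S (\<lambda>x. L (f x))"
  by (rule smooth_on_compose[of S UNIV]) (auto intro: smooth_on_linear)

lemma smooth_on_Pair:
  fixes f :: "'a::real_normed_vector \<Rightarrow> 'b::euclidean_space"
    and g :: "'a::real_normed_vector \<Rightarrow> 'c::euclidean_space"
  assumes "open S" "smooth_on S f" "smooth_on S g"
  shows "smooth_on S (\<lambda>x. (f x, g x))"
proof -
  have "linear (\<lambda>y::'b. (y, 0::'c))" "linear (\<lambda>z::'c. (0::'b, z))"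
    by (auto intro!: linearI)
  from smooth_on_add[OF assms(1) smooth_on_linear_compose[OF this(1) assms(1,2)]
      smooth_on_linear_compose[OF this(2) assms(1,3)]]
  show ?thesis by simp
qed

text \<open>Differentiating a power of \<open>x\<close> gives a multiple of another power, so an induction that is
  uniform in the exponent covers all orders; the square root is the exponent \<open>1 / 2\<close>.\<close>

lemma smooth_on_powr: "smooth_on {0<..} (\<lambda>x::real. x powr a)"
proof -
  have "higher_differentiable_on {0<..} (\<lambda>x::real. c * x powr a) n" for n c
  proof (induction n arbitrary: c a)
    case 0
    have "continuous_on {0<..} (\<lambda>x::real. c * x powr a)"
      by (intro continuous_on_mult continuous_on_const continuous_on_powr continuous_on_id) auto
    then show ?case by simp
  next
    case (Suc n)
    show ?case
    proof (rule higher_differentiable_on_SucI)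
      show "((\<lambda>x. c * x powr a) has_derivative (\<lambda>v. (c * (a * x powr (a - 1))) * v)) (at x)"
        if "x \<in> {0<..}" for x
        using that
        by (intro has_field_derivative_imp_has_derivative DERIV_cmult has_real_derivative_powr) simp
      show "higher_differentiable_on {0<..} (\<lambda>x. (c * (a * x powr (a - 1))) * v) n" for v
        using Suc.IH[of "c * a * v" "a - 1"] by (simp only: mult.assoc mult.left_commute mult.commute)
    qed simp
  qed
  from this[of 1] show ?thesis by (simp add: smooth_on_def)
qed

lemma smooth_on_sqrt: "smooth_on {0<..} sqrt"
  by (rule smooth_on_cong[OF _ smooth_on_powr[of "1/2"]]) (auto simp: powr_half_sqrt)


section \<open>Charts of embedded submanifolds\<close>

text \<open>A chart on a subset of a Euclidean space whose inverse is smooth as a map into the ambient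
  space.  Slice charts and products of slice charts share this property, so maps defined on a
  submanifold and on a product of submanifolds can be treated together.\<close>

definition smooth_parametrization ::
    "'a::euclidean_space set \<Rightarrow> ('a \<Rightarrow> 'b::euclidean_space) \<Rightarrow> bool" where
  "smooth_parametrization U \<phi> \<longleftrightarrow>
     open (\<phi> ` U) \<and> inj_on \<phi> U \<and> smooth_on (\<phi> ` U) (inv_into U \<phi>)"

lemma slice_chart_image:
  fixes \<Phi> :: "'a::euclidean_space \<Rightarrow> 'b::euclidean_space \<times> 'c::euclidean_space"
  assumes "slice_chart S W \<Phi>"
  shows "(fst \<circ> \<Phi>) ` (W \<inter> S) = (\<lambda>y. (y, 0)) -` (\<Phi> ` W)"
proof -
  have "fst ` (A \<inter> (UNIV \<times> {0})) = (\<lambda>y. (y, 0)) -` A" for A :: "('b \<times> 'c) set"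
    by (auto simp: image_iff Bex_def)
  then show ?thesis
    using assms by (simp only: slice_chart_def image_comp[symmetric])
qed

lemma slice_chart_snd:
  assumes "slice_chart S W \<Phi>" "x \<in> W \<inter> S"
  shows "\<Phi> x = (fst (\<Phi> x), 0)"
proof -
  have "\<Phi> x \<in> \<Phi> ` (W \<inter> S)" using assms(2) by (rule imageI)
  also have "\<dots> \<subseteq> UNIV \<times> {0}" using assms(1) by (simp add: slice_chart_def)
  finally show ?thesis by (simp add: mem_Times_iff prod_eq_iff)
qed

lemma slice_chart_inj:
  assumes "slice_chart S W \<Phi>"
  shows "inj_on (fst \<circ> \<Phi>) (W \<inter> S)"
proof (rule inj_onI)
  fix x y assume xy: "x \<in> W \<inter> S" "y \<in> W \<inter> S" "(fst \<circ> \<Phi>) x = (fst \<circ> \<Phi>) y"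
  then have "\<Phi> x = \<Phi> y"
    using slice_chart_snd[OF assms xy(1)] slice_chart_snd[OF assms xy(2)] by simp
  then show "x = y"
    using assms xy(1,2) by (auto simp: slice_chart_def diffeomorphism_on_def dest: inj_onD)
qed

text \<open>The normal coordinates vanish on the slice, so tangential coordinates \<open>y\<close> belong to the ambient
  coordinates \<open>(y, 0)\<close>.\<close>

lemma slice_chart_inv_into:
  assumes "slice_chart S W \<Phi>" "y \<in> (fst \<circ> \<Phi>) ` (W \<inter> S)"
  shows "inv_into (W \<inter> S) (fst \<circ> \<Phi>) y = inv_into W \<Phi> (y, 0)"
proof -
  obtain x where x: "x \<in> W \<inter> S" "y = fst (\<Phi> x)" using assms(2) by auto
  then have "inv_into (W \<inter> S) (fst \<circ> \<Phi>) y = x"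
    using inv_into_f_f[OF slice_chart_inj[OF assms(1)] x(1)] by simp
  moreover have "inv_into W \<Phi> (\<Phi> x) = x"
    using assms(1) x(1) by (intro inv_into_f_f) (auto simp: slice_chart_def diffeomorphism_on_def)
  ultimately show ?thesis using slice_chart_snd[OF assms(1) x(1)] x(2) by simp
qed

lemma linear_Pair_0: "linear (\<lambda>y. (y, 0))"
  by (auto intro!: linearI)

lemma slice_chart_smooth_parametrization:
  fixes \<Phi> :: "'a::euclidean_space \<Rightarrow> 'b::euclidean_space \<times> 'c::euclidean_space"
  assumes "slice_chart S W \<Phi>"
  shows "smooth_parametrization (W \<inter> S) (fst \<circ> \<Phi>)"
proof -
  let ?U = "(fst \<circ> \<Phi>) ` (W \<inter> S)"
  have \<Phi>: "open (\<Phi> ` W)" "smooth_on (\<Phi> ` W) (inv_into W \<Phi>)"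
    using assms by (auto simp: slice_chart_def diffeomorphism_on_def)
  have op: "open ?U"
    unfolding slice_chart_image[OF assms]
    by (intro continuous_open_vimage \<Phi>(1)) (auto intro!: continuous_intros)
  have "(\<lambda>y. (y, 0)) ` ?U \<subseteq> \<Phi> ` W"
    unfolding slice_chart_image[OF assms] by (rule image_vimage_subset)
  then have "smooth_on ?U (\<lambda>y. inv_into W \<Phi> (y, 0))"
    by (rule smooth_on_compose[OF op \<Phi>(1) _ smooth_on_linear[OF linear_Pair_0 op] \<Phi>(2)])
  then have "smooth_on ?U (inv_into (W \<inter> S) (fst \<circ> \<Phi>))"
    by (rule smooth_on_cong[OF op]) (simp add: slice_chart_inv_into[OF assms])
  then show ?thesis
    using op slice_chart_inj[OF assms] by (simp add: smooth_parametrization_def)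
qed

lemma smooth_parametrization_Times:
  fixes \<phi> :: "'a::euclidean_space \<Rightarrow> 'b::euclidean_space"
    and \<psi> :: "'c::euclidean_space \<Rightarrow> 'd::euclidean_space"
  assumes "smooth_parametrization U \<phi>" "smooth_parametrization V \<psi>"
  shows "smooth_parametrization (U \<times> V) (map_prod \<phi> \<psi>)"
proof -
  have im: "map_prod \<phi> \<psi> ` (U \<times> V) = \<phi> ` U \<times> \<psi> ` V" by (auto simp: map_prod_def)
  have op: "open (\<phi> ` U)" "open (\<psi> ` V)" and inj: "inj_on \<phi> U" "inj_on \<psi> V"
    and sm: "smooth_on (\<phi> ` U) (inv_into U \<phi>)" "smooth_on (\<psi> ` V) (inv_into V \<psi>)"
    using assms by (auto simp: smooth_parametrization_def)
  have op': "open (\<phi> ` U \<times> \<psi> ` V)" using op by (rule open_Times)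
  have inj': "inj_on (map_prod \<phi> \<psi>) (U \<times> V)" using inj by (rule map_prod_inj_on)
  have "smooth_on (\<phi> ` U \<times> \<psi> ` V) (\<lambda>z. (inv_into U \<phi> (fst z), inv_into V \<psi> (snd z)))"
    by (intro smooth_on_Pair op'
        smooth_on_compose[OF op' op(1) _ smooth_on_linear[OF linear_fst op'] sm(1)]
        smooth_on_compose[OF op' op(2) _ smooth_on_linear[OF linear_snd op'] sm(2)]) auto
  then have "smooth_on (\<phi> ` U \<times> \<psi> ` V) (inv_into (U \<times> V) (map_prod \<phi> \<psi>))"
  proof (rule smooth_on_cong[OF op'])
    fix z assume "z \<in> \<phi> ` U \<times> \<psi> ` V"
    then obtain u v where uv: "u \<in> U" "v \<in> V" "z = map_prod \<phi> \<psi> (u, v)" by auto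
    then have "inv_into (U \<times> V) (map_prod \<phi> \<psi>) z = (u, v)"
      using inv_into_f_f[OF inj', of "(u, v)"] by simp
    then show "(inv_into U \<phi> (fst z), inv_into V \<psi> (snd z)) = inv_into (U \<times> V) (map_prod \<phi> \<psi>) z"
      using uv inj by simp
  qed
  then show ?thesis using op' inj' im by (simp add: smooth_parametrization_def)
qed

text \<open>In local coordinates a map that is the restriction of a smooth ambient map \<open>F\<close> is the
  composite of the parametrization, \<open>F\<close>, and a slice chart of the target, each smooth on an open
  set.  The map \<open>f\<close> is kept apart from \<open>F\<close> because the inversion of a group is determined only on
  the carrier, where it agrees with a smooth ambient map.\<close>

lemma smooth_on_coordinates:
  fixes \<phi> :: "'a::euclidean_space \<Rightarrow> 'b::euclidean_space"
    and \<Psi> :: "'c::euclidean_space \<Rightarrow> 'd::euclidean_space \<times> 'e::euclidean_space"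
  assumes "smooth_parametrization U \<phi>" "smooth_on UNIV F" "slice_chart T W \<Psi>"
    and f: "\<And>x. x \<in> U \<Longrightarrow> f x = F x" "f ` U \<subseteq> T"
  shows "smooth_on (\<phi> ` (U \<inter> f -` (W \<inter> T))) ((fst \<circ> \<Psi>) \<circ> f \<circ> inv_into U \<phi>)"
proof -
  let ?h = "\<lambda>y. F (inv_into U \<phi> y)"
  let ?D = "\<phi> ` U \<inter> ?h -` W"
  have \<phi>: "open (\<phi> ` U)" "inj_on \<phi> U" "smooth_on (\<phi> ` U) (inv_into U \<phi>)"
    using assms(1) by (auto simp: smooth_parametrization_def)
  have W: "open W" "smooth_on W \<Psi>"
    using assms(3) by (auto simp: slice_chart_def diffeomorphism_on_def)
  have D: "\<phi> ` (U \<inter> f -` (W \<inter> T)) = ?D"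
  proof
    show "?D \<subseteq> \<phi> ` (U \<inter> f -` (W \<inter> T))"
    proof
      fix y assume "y \<in> ?D"
      then obtain x where x: "x \<in> U" "y = \<phi> x" "F x \<in> W" using \<phi>(2) by auto
      then have "f x \<in> W \<inter> T" using f by auto
      then show "y \<in> \<phi> ` (U \<inter> f -` (W \<inter> T))" using x by auto
    qed
  qed (use f(1) \<phi>(2) in auto)
  have h: "smooth_on (\<phi> ` U) ?h"
    by (rule smooth_on_compose[OF \<phi>(1) _ _ \<phi>(3) assms(2)]) auto
  have opD: "open ?D"
    by (rule continuous_open_preimage[OF smooth_on_imp_continuous_on[OF h] \<phi>(1) W(1)])
  have "smooth_on ?D (\<lambda>y. \<Psi> (?h y))"
    by (rule smooth_on_compose[OF opD W(1) _ smooth_on_subset[OF h] W(2)]) auto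
  then have "smooth_on ?D (\<lambda>y. fst (\<Psi> (?h y)))"
    by (rule smooth_on_linear_compose[OF linear_fst opD])
  then have "smooth_on ?D ((fst \<circ> \<Psi>) \<circ> f \<circ> inv_into U \<phi>)"
    by (rule smooth_on_cong[OF opD]) (use f(1) inv_into_into[of _ \<phi> U] in auto)
  then show ?thesis unfolding D .
qed

lemma slice_chart_is_chart:
  assumes "slice_chart S W \<Phi>"
  shows "is_chart (top_of_set S) (W \<inter> S, fst \<circ> \<Phi>)"
proof -
  let ?\<phi> = "fst \<circ> \<Phi>"
  let ?U = "W \<inter> S"
  have W: "open W" "smooth_on W \<Phi>"
    using assms by (auto simp: slice_chart_def diffeomorphism_on_def)
  have \<phi>: "open (?\<phi> ` ?U)" "inj_on ?\<phi> ?U" "smooth_on (?\<phi> ` ?U) (inv_into ?U ?\<phi>)"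
    using slice_chart_smooth_parametrization[OF assms] by (auto simp: smooth_parametrization_def)
  have "continuous_on ?U ?\<phi>"
    using smooth_on_imp_continuous_on[OF W(2)]
    by (auto intro!: continuous_intros intro: continuous_on_subset simp: comp_def)
  then have "homeomorphic_maps (top_of_set ?U) (top_of_set (?\<phi> ` ?U)) ?\<phi> (inv_into ?U ?\<phi>)"
    unfolding homeomorphic_maps_def
    using smooth_on_imp_continuous_on[OF \<phi>(3)] inv_into_f_f[OF \<phi>(2)] inv_into_into[of _ ?\<phi> ?U]
      f_inv_into_f[of _ ?\<phi> ?U]
    by (auto simp: continuous_map_in_subtopology)
  then have "homeomorphic_map (top_of_set ?U) (top_of_set (?\<phi> ` ?U)) ?\<phi>"
    using homeomorphic_map_maps by blast
  moreover have "subtopology (top_of_set S) ?U = top_of_set ?U"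
    by (simp add: subtopology_subtopology Int_commute)
  moreover have "openin (top_of_set S) ?U"
    using W(1) by (simp add: Int_commute openin_open_Int)
  ultimately show ?thesis using \<phi>(1) by (simp add: is_chart_def)
qed

lemma submanifold_atlasE:
  fixes S :: "'a::euclidean_space set" and \<phi> :: "'a \<Rightarrow> 'b::euclidean_space"
  assumes "(U, \<phi>) \<in> submanifold_atlas TYPE('c::euclidean_space) S"
  obtains W and \<Phi> :: "'a \<Rightarrow> 'b \<times> 'c::euclidean_space"
  where "U = W \<inter> S" "\<phi> = fst \<circ> \<Phi>" "slice_chart S W \<Phi>"
  using assms by (auto simp: submanifold_atlas_def)

lemma second_countable_euclidean:
  "second_countable (euclidean :: 'a::second_countable_topology topology)"
proof -
  obtain B :: "'a set set" where B: "countable B" "topological_basis B"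
    using ex_countable_basis by blast
  have "\<exists>V\<in>B. x \<in> V \<and> V \<subseteq> U" if "open U" "x \<in> U" for U x
    using topological_basisE[OF B(2) that] by metis
  then show ?thesis
    unfolding second_countable_def using B topological_basis_open[OF B(2)]
    by (auto intro!: exI[where x = B])
qed

text \<open>An embedded submanifold is a smooth manifold: transition maps are the coordinate expressions
  of the identity.\<close>

text \<open>Transition maps are the coordinate expressions of the identity, so their smoothness is an
  instance of \<open>smooth_on_coordinates\<close>.\<close>

lemma smooth_manifold_submanifold_atlas:
  fixes S :: "'a::euclidean_space set"
  assumes cover: "\<And>x. x \<in> S \<Longrightarrow>
      \<exists>W (\<Phi> :: 'a \<Rightarrow> 'b::euclidean_space \<times> 'c::euclidean_space). slice_chart S W \<Phi> \<and> x \<in> W"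
  shows "smooth_manifold (top_of_set S) (submanifold_atlas TYPE('c) S :: ('a, 'b) chart set)"
    (is "smooth_manifold _ ?A")
proof
  show "Hausdorff_space (top_of_set S)"
    by (simp add: Hausdorff_space_subtopology)
  show "second_countable (top_of_set S)"
    by (intro second_countable_subtopology second_countable_euclidean)
  show "is_chart (top_of_set S) c" if "c \<in> ?A" for c
    using that slice_chart_is_chart by (cases c) (auto elim!: submanifold_atlasE)
  show "topspace (top_of_set S) = (\<Union>(U, \<phi>)\<in>?A. U)"
  proof
    show "topspace (top_of_set S) \<subseteq> (\<Union>(U, \<phi>)\<in>?A. U)"
    proof
      fix x assume "x \<in> topspace (top_of_set S)"
      then obtain W and \<Phi> :: "'a \<Rightarrow> 'b \<times> 'c" where "slice_chart S W \<Phi>" "x \<in> W" "x \<in> S"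
        using cover by (metis topspace_euclidean_subtopology)
      then have "(W \<inter> S, fst \<circ> \<Phi>) \<in> ?A" "x \<in> W \<inter> S" by (auto simp: submanifold_atlas_def)
      then show "x \<in> (\<Union>(U, \<phi>)\<in>?A. U)" by fast
    qed
  qed (auto elim!: submanifold_atlasE)
  show "smooth_on (\<phi> ` (U \<inter> V)) (\<psi> \<circ> inv_into U \<phi>)"
    if U: "(U, \<phi>) \<in> ?A" and V: "(V, \<psi>) \<in> ?A" for U \<phi> V \<psi>
  proof -
    obtain W \<Phi> where W: "U = W \<inter> S" "\<phi> = fst \<circ> \<Phi>" "slice_chart S W (\<Phi> :: 'a \<Rightarrow> 'b \<times> 'c)"
      using U by (rule submanifold_atlasE)
    obtain W' \<Psi> where W': "V = W' \<inter> S" "\<psi> = fst \<circ> \<Psi>" "slice_chart S W' (\<Psi> :: 'a \<Rightarrow> 'b \<times> 'c)"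
      using V by (rule submanifold_atlasE)
    have "smooth_on (\<phi> ` (U \<inter> id -` V)) (\<psi> \<circ> id \<circ> inv_into U \<phi>)"
      unfolding W(1,2) W'(1,2)
      by (rule smooth_on_coordinates[OF slice_chart_smooth_parametrization[OF W(3)]
            smooth_on_linear[OF linear_id] W'(3)]) auto
    then show ?thesis by simp
  qed
qed

lemma smooth_map_submanifold:
  fixes S :: "'a::euclidean_space set" and T :: "'d::euclidean_space set"
    and A :: "('a, 'b::euclidean_space) chart set"
    and F :: "'a \<Rightarrow> 'd"
  assumes "smooth_on UNIV F" "\<And>x. x \<in> S \<Longrightarrow> f x = F x" "f ` S \<subseteq> T"
    and A: "\<And>U \<phi>. (U, \<phi>) \<in> A \<Longrightarrow> U \<subseteq> S \<and> smooth_parametrization U \<phi>"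
  shows "smooth_map (top_of_set S) A (top_of_set T)
    (submanifold_atlas TYPE('c::euclidean_space) T :: ('d, 'e::euclidean_space) chart set) f"
    (is "smooth_map _ _ _ ?B _")
proof -
  have "continuous_on S F"
    using smooth_on_imp_continuous_on[OF assms(1)] by (rule continuous_on_subset) simp
  then have "continuous_on S f" using assms(2) by (simp cong: continuous_on_cong)
  moreover have "smooth_on (\<phi> ` (U \<inter> f -` V)) (\<psi> \<circ> f \<circ> inv_into U \<phi>)"
    if U: "(U, \<phi>) \<in> A" and V: "(V, \<psi>) \<in> ?B" for U \<phi> V \<psi>
  proof -
    obtain W \<Psi> where W: "V = W \<inter> T" "\<psi> = fst \<circ> \<Psi>" "slice_chart T W (\<Psi> :: 'd \<Rightarrow> 'e \<times> 'c)"
      using V by (rule submanifold_atlasE)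
    show ?thesis
      unfolding W(1,2)
      by (rule smooth_on_coordinates[OF _ assms(1) W(3)]) (use A[OF U] assms(2,3) in auto)
  qed
  ultimately show ?thesis
    using assms(3) by (auto simp: smooth_map_def continuous_map_in_subtopology)
qed

lemma submanifold_atlas_parametrization:
  fixes S :: "'a::euclidean_space set" and \<phi> :: "'a \<Rightarrow> 'b::euclidean_space"
  assumes "(U, \<phi>) \<in> submanifold_atlas TYPE('c::euclidean_space) S"
  shows "U \<subseteq> S \<and> smooth_parametrization U \<phi>"
  using assms by (auto elim!: submanifold_atlasE slice_chart_smooth_parametrization)

lemma prod_atlas_parametrization:
  fixes A :: "('a::euclidean_space, 'b::euclidean_space) chart set"
    and B :: "('c::euclidean_space, 'd::euclidean_space) chart set"
  assumes "\<And>U \<phi>. (U, \<phi>) \<in> A \<Longrightarrow> U \<subseteq> S \<and> smooth_parametrization U \<phi>"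
    and "\<And>V \<psi>. (V, \<psi>) \<in> B \<Longrightarrow> V \<subseteq> T \<and> smooth_parametrization V \<psi>"
    and "(P, \<rho>) \<in> prod_atlas A B"
  shows "P \<subseteq> S \<times> T \<and> smooth_parametrization P \<rho>"
proof -
  obtain U \<phi> V \<psi> where "P = U \<times> V" "\<rho> = map_prod \<phi> \<psi>" "(U, \<phi>) \<in> A" "(V, \<psi>) \<in> B"
    using assms(3) by (auto simp: prod_atlas_def)
  then show ?thesis using assms(1,2) smooth_parametrization_Times by blast
qed

text \<open>Linear symmetries of \<open>S\<close> carry slice charts to slice charts; for a group of symmetries acting
  transitively, the translates of one nonempty chart of \<open>S\<close> therefore cover \<open>S\<close>.\<close>

lemma slice_chart_linear_image:
  fixes \<Phi> :: "'a::euclidean_space \<Rightarrow> 'b::euclidean_space \<times> 'c::euclidean_space"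
  assumes \<Phi>: "slice_chart S W \<Phi>"
    and lin: "linear L" "linear M" and inv: "\<And>x. M (L x) = x" "\<And>x. L (M x) = x"
    and S: "L ` S = S"
  shows "slice_chart S (L ` W) (\<Phi> \<circ> M)"
proof -
  have W: "open W" "open (\<Phi> ` W)" "inj_on \<Phi> W" "smooth_on W \<Phi>"
      "smooth_on (\<Phi> ` W) (inv_into W \<Phi>)" "\<Phi> ` (W \<inter> S) = \<Phi> ` W \<inter> (UNIV \<times> {0})"
    using \<Phi> by (auto simp: slice_chart_def diffeomorphism_on_def)
  have im: "(\<Phi> \<circ> M) ` L ` X = \<Phi> ` X" for X using inv by (simp add: image_comp comp_def)
  have LW: "L ` W = M -` W"
    using inv(1) inv(2)[symmetric] by (auto intro: image_eqI)
  have op: "open (L ` W)"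
    unfolding LW using W(1) lin(2)
    by (intro continuous_open_vimage) (auto simp: linear_continuous_at linear_conv_bounded_linear)
  have inj: "inj_on (\<Phi> \<circ> M) (L ` W)"
    using W(3) inv by (auto simp: inj_on_def)
  have "L ` W \<inter> S = L ` (W \<inter> S)"
    using S inv by (metis image_Int inj_on_inverseI)
  then have flat: "(\<Phi> \<circ> M) ` (L ` W \<inter> S) = (\<Phi> \<circ> M) ` L ` W \<inter> (UNIV \<times> {0})"
    using im W(6) by simp
  have sm: "smooth_on (L ` W) (\<Phi> \<circ> M)"
    unfolding comp_def
    by (rule smooth_on_compose[OF op W(1) _ smooth_on_linear[OF lin(2) op] W(4)])
      (use inv in auto)
  have "smooth_on (\<Phi> ` W) (\<lambda>y. L (inv_into W \<Phi> y))"
    using smooth_on_linear_compose[OF lin(1) W(2,5)] .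
  then have "smooth_on (\<Phi> ` W) (inv_into (L ` W) (\<Phi> \<circ> M))"
  proof (rule smooth_on_cong[OF W(2)])
    fix y assume "y \<in> \<Phi> ` W"
    then obtain x where x: "x \<in> W" "y = \<Phi> x" by auto
    then have "inv_into (L ` W) (\<Phi> \<circ> M) y = L x"
      using inv_into_f_f[OF inj, of "L x"] inv by simp
    then show "L (inv_into W \<Phi> y) = inv_into (L ` W) (\<Phi> \<circ> M) y"
      using x W(3) by simp
  qed
  then show ?thesis
    unfolding slice_chart_def diffeomorphism_on_def
    using op inj flat sm im W(2) by simp
qed


section \<open>The group of generalized quaternions of norm one\<close>

text \<open>Subtracting from twice the real part keeps the real part and negates the imaginary part, and
  makes linearity evident.\<close>

definition gq_conj :: "real^4 \<Rightarrow> real^4" where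
  "gq_conj p = (2 * p $ 0) *\<^sub>R gq_e 0 - p"

lemma gq_conj_nth:
  "gq_conj p $ 0 = p $ 0" "gq_conj p $ 1 = - p $ 1" "gq_conj p $ 2 = - p $ 2" "gq_conj p $ 3 = - p $ 3"
  by (simp_all add: gq_conj_def gq_e_def axis_def)

lemma linear_gq_conj: "linear gq_conj"
  by (auto intro!: linearI simp: gq_conj_def algebra_simps)

lemma gq_norm_conj: "gq_norm l1 l2 l3 (gq_conj p) = gq_norm l1 l2 l3 p"
  by (simp add: gq_norm_def gq_conj_nth)

lemma gq_mult_conj:
  "gq_mult l1 l2 l3 (gq_conj p) p = gq_norm l1 l2 l3 p *\<^sub>R gq_e 0"
  "gq_mult l1 l2 l3 p (gq_conj p) = gq_norm l1 l2 l3 p *\<^sub>R gq_e 0"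
  by (simp_all add: vec_eq_iff forall_4_from_0 gq_mult_nth gq_conj_nth gq_norm_def gq_e_def axis_def
      power2_eq_square algebra_simps)

lemma gq_norm_unit: "gq_norm l1 l2 l3 (gq_e 0) = 1"
  by (simp add: gq_norm_def gq_e_def axis_def)

lemma gq_sphere_closed:
  "gq_e 0 \<in> gq_sphere l1 l2 l3"
  "p \<in> gq_sphere l1 l2 l3 \<Longrightarrow> gq_conj p \<in> gq_sphere l1 l2 l3"
  "p \<in> gq_sphere l1 l2 l3 \<Longrightarrow> q \<in> gq_sphere l1 l2 l3 \<Longrightarrow> gq_mult l1 l2 l3 p q \<in> gq_sphere l1 l2 l3"
  by (simp_all add: gq_sphere_def gq_norm_unit gq_norm_conj gq_norm_mult)

lemma gq_sphere_mult_conj: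
  assumes "p \<in> gq_sphere l1 l2 l3"
  shows "gq_mult l1 l2 l3 (gq_conj p) p = gq_e 0" "gq_mult l1 l2 l3 p (gq_conj p) = gq_e 0"
  using assms by (simp_all add: gq_mult_conj gq_sphere_def)

lemma group_gq_sphere: "group (gq_sphere_monoid l1 l2 l3)"
  by (rule groupI)
    (auto simp: gq_sphere_monoid_def gq_sphere_closed gq_mult_assoc gq_mult_unit
      intro!: bexI[where x = "gq_conj _"] gq_sphere_mult_conj gq_sphere_closed)

lemma inv_gq_sphere:
  assumes "p \<in> gq_sphere l1 l2 l3"
  shows "inv\<^bsub>gq_sphere_monoid l1 l2 l3\<^esub> p = gq_conj p"
  by (rule group.inv_equality[OF group_gq_sphere])
    (use assms in \<open>simp_all add: gq_sphere_monoid_def gq_sphere_closed gq_sphere_mult_conj\<close>)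


section \<open>Slice charts of the norm-one hypersurface\<close>

lemma linear_vec_nth: "linear (\<lambda>x::real^'n. x $ i)"
  by (auto intro!: linearI)

lemmas smooth_on_vec_nth = smooth_on_linear_compose[OF linear_vec_nth]

definition gq_imag :: "real^4 \<Rightarrow> real^3" where
  "gq_imag p = p $ 1 *\<^sub>R axis 1 1 + p $ 2 *\<^sub>R axis 2 1 + p $ 3 *\<^sub>R axis 3 1"

definition gq_of_parts :: "real \<Rightarrow> real^3 \<Rightarrow> real^4" where
  "gq_of_parts a y = a *\<^sub>R gq_e 0 + y $ 1 *\<^sub>R gq_e 1 + y $ 2 *\<^sub>R gq_e 2 + y $ 3 *\<^sub>R gq_e 3"

lemma gq_imag_nth: "gq_imag p $ 1 = p $ 1" "gq_imag p $ 2 = p $ 2" "gq_imag p $ 3 = p $ 3"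
  by (simp_all add: gq_imag_def axis_def)

lemma gq_of_parts_nth:
  "gq_of_parts a y $ 0 = a" "gq_of_parts a y $ 1 = y $ 1"
  "gq_of_parts a y $ 2 = y $ 2" "gq_of_parts a y $ 3 = y $ 3"
  by (simp_all add: gq_of_parts_def gq_e_def axis_def)

lemma gq_of_parts_imag: "gq_of_parts (p $ 0) (gq_imag p) = p"
  by (simp add: vec_eq_iff forall_4_from_0 gq_of_parts_nth gq_imag_nth)

lemma gq_imag_of_parts: "gq_imag (gq_of_parts a y) = y"
  by (simp add: vec_eq_iff forall_3 gq_of_parts_nth gq_imag_nth)

definition gq_imag_norm :: "real \<Rightarrow> real \<Rightarrow> real \<Rightarrow> real^3 \<Rightarrow> real" where
  "gq_imag_norm l1 l2 l3 y =
     (l1 * l2) * (y $ 1 * y $ 1) + (l1 * l3) * (y $ 2 * y $ 2) + (l2 * l3) * (y $ 3 * y $ 3)"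

lemma gq_norm_split: "gq_norm l1 l2 l3 p = p $ 0 * p $ 0 + gq_imag_norm l1 l2 l3 (gq_imag p)"
  by (simp add: gq_norm_def gq_imag_norm_def gq_imag_nth power2_eq_square)

lemma smooth_on_gq_imag_norm:
  assumes "open S" "smooth_on S f"
  shows "smooth_on S (\<lambda>x. gq_imag_norm l1 l2 l3 (f x))"
  unfolding gq_imag_norm_def
  by (intro smooth_on_add smooth_on_mult smooth_on_const smooth_on_vec_nth assms)

lemma smooth_on_gq_imag: "smooth_on UNIV gq_imag"
  by (rule smooth_on_linear) (auto intro!: linearI simp: gq_imag_def algebra_simps)

text \<open>Around the unit the real part is positive, so it can be recovered from the norm and the
  imaginary part by a square root whose argument stays positive.  Hence imaginary part and norm
  form a slice chart on the half-space of positive real part.\<close>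

definition gq_unit_chart :: "real \<Rightarrow> real \<Rightarrow> real \<Rightarrow> real^4 \<Rightarrow> (real^3) \<times> real" where
  "gq_unit_chart l1 l2 l3 p = (gq_imag p, gq_norm l1 l2 l3 p - 1)"

lemma slice_chart_gq_unit:
  "slice_chart (gq_sphere l1 l2 l3) {p. p $ 0 > 0} (gq_unit_chart l1 l2 l3)"
proof -
  let ?W = "{p :: real^4. p $ 0 > 0}" and ?\<Phi> = "gq_unit_chart l1 l2 l3"
  \<comment> \<open>\<open>?r z\<close> is the square of the real part of the point with coordinates \<open>z\<close>.  The product with
    \<open>- 1\<close> lets the rules for sums and products apply.\<close>
  let ?r = "\<lambda>z :: (real^3) \<times> real. snd z + 1 + (- 1) * gq_imag_norm l1 l2 l3 (fst z)"
  let ?D = "{z. ?r z > 0}"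
  let ?g = "\<lambda>z. gq_of_parts (sqrt (?r z)) (fst z)"
  have opW: "open ?W"
    by (intro open_Collect_less continuous_intros)
  have r: "smooth_on UNIV ?r"
    by (intro smooth_on_add smooth_on_mult smooth_on_const smooth_on_gq_imag_norm smooth_on_linear
        linear_fst linear_snd open_UNIV)
  have opD: "open ?D"
    using smooth_on_imp_continuous_on[OF r] by (intro open_Collect_less continuous_on_const)
  have rW: "?r (?\<Phi> p) = p $ 0 * p $ 0" for p
    by (simp add: gq_unit_chart_def gq_norm_split)
  have g\<Phi>: "?g (?\<Phi> p) = p" if "p \<in> ?W" for p
    using that unfolding rW by (simp add: gq_unit_chart_def gq_of_parts_imag)
  have \<Phi>D: "?\<Phi> p \<in> ?D" if "p \<in> ?W" for p
    using that unfolding mem_Collect_eq rW by simp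
  have gW: "?g z \<in> ?W" if "z \<in> ?D" for z
    using that by (simp add: gq_of_parts_nth)
  have \<Phi>g: "?\<Phi> (?g z) = z" if "z \<in> ?D" for z
    using that by (simp add: gq_unit_chart_def gq_norm_split gq_imag_of_parts gq_of_parts_nth prod_eq_iff)
  have im: "?\<Phi> ` ?W = ?D"
  proof
    show "?D \<subseteq> ?\<Phi> ` ?W" using gW \<Phi>g by (metis (no_types, lifting) image_eqI subsetI)
  qed (use \<Phi>D in blast)
  have inj: "inj_on ?\<Phi> ?W" using g\<Phi> by (rule inj_on_inverseI)
  have "smooth_on UNIV (\<lambda>p :: real^4. p $ 0 * p $ 0 + gq_imag_norm l1 l2 l3 (gq_imag p) + (- 1))"
    by (intro smooth_on_add smooth_on_mult smooth_on_const smooth_on_gq_imag_norm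
        smooth_on_linear[OF linear_vec_nth] smooth_on_gq_imag open_UNIV)
  then have "smooth_on UNIV ?\<Phi>"
    using smooth_on_Pair[OF open_UNIV smooth_on_gq_imag]
    by (simp add: gq_unit_chart_def[abs_def] gq_norm_split)
  then have sm: "smooth_on ?W ?\<Phi>" by (rule smooth_on_subset) simp
  have root: "smooth_on ?D (\<lambda>z. sqrt (?r z))"
    by (rule smooth_on_compose[OF opD _ _ smooth_on_subset[OF r] smooth_on_sqrt]) auto
  have "smooth_on ?D ?g"
    unfolding gq_of_parts_def
    by (intro smooth_on_add smooth_on_scaleR smooth_on_const smooth_on_vec_nth root
        smooth_on_linear[OF linear_fst] opD)
  then have sm': "smooth_on ?D (inv_into ?W ?\<Phi>)"
  proof (rule smooth_on_cong[OF opD])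
    show "?g z = inv_into ?W ?\<Phi> z" if "z \<in> ?D" for z
      using inv_into_f_f[OF inj gW[OF that]] \<Phi>g[OF that] by simp
  qed
  have "?\<Phi> ` (?W \<inter> gq_sphere l1 l2 l3) = ?\<Phi> ` ?W \<inter> (UNIV \<times> {0})"
    by (auto simp: gq_unit_chart_def gq_sphere_def)
  then show ?thesis
    unfolding slice_chart_def diffeomorphism_on_def using opW opD inj sm sm' im by simp
qed

lemma gq_sphere_slice_chart_exists:
  assumes p: "p \<in> gq_sphere l1 l2 l3"
  shows "\<exists>W (\<Phi> :: real^4 \<Rightarrow> (real^3) \<times> real). slice_chart (gq_sphere l1 l2 l3) W \<Phi> \<and> p \<in> W"
proof -
  let ?S = "gq_sphere l1 l2 l3" and ?W = "{p :: real^4. p $ 0 > 0}"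
  let ?L = "gq_mult l1 l2 l3 p" and ?M = "gq_mult l1 l2 l3 (gq_conj p)"
  have inv: "?M (?L x) = x" "?L (?M x) = x" for x
    by (simp_all add: gq_mult_assoc[symmetric] gq_sphere_mult_conj[OF p] gq_mult_unit)
  have lin: "linear ?L" "linear ?M" using bilinear_gq_mult by (auto simp: bilinear_def)
  have "?L ` ?S = ?S"
  proof
    show "?S \<subseteq> ?L ` ?S"
    proof
      fix x assume "x \<in> ?S"
      then have "?M x \<in> ?S" using p gq_sphere_closed by blast
      then show "x \<in> ?L ` ?S" using inv(2)[of x] by (metis image_eqI)
    qed
  qed (use p gq_sphere_closed in auto)
  then have "slice_chart ?S (?L ` ?W) (gq_unit_chart l1 l2 l3 \<circ> ?M)"
    by (intro slice_chart_linear_image slice_chart_gq_unit lin inv)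
  moreover have "p \<in> ?L ` ?W"
  proof
    show "p = ?L (gq_e 0)" by (simp add: gq_mult_unit)
  qed (simp add: gq_e_def axis_def)
  ultimately show ?thesis by blast
qed


section \<open>The Lie group\<close>

theorem theorem5p1:
  fixes l1 l2 l3 :: real
  shows "lie_group (gq_sphere_monoid l1 l2 l3) (top_of_set (gq_sphere l1 l2 l3))
           (submanifold_atlas TYPE(real) (gq_sphere l1 l2 l3) :: (real^4, real^3) chart set)"
proof -
  let ?G = "gq_sphere_monoid l1 l2 l3" and ?S = "gq_sphere l1 l2 l3"
  let ?A = "submanifold_atlas TYPE(real) ?S :: (real^4, real^3) chart set"
  have mult: "mult ?G = gq_mult l1 l2 l3" by (simp add: gq_sphere_monoid_def)
  have bil: "bounded_bilinear (gq_mult l1 l2 l3)"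
    using bilinear_gq_mult by (simp add: bilinear_conv_bounded_bilinear)
  have "smooth_map (top_of_set (?S \<times> ?S)) (prod_atlas ?A ?A) (top_of_set ?S) ?A
      (\<lambda>(x, y). x \<otimes>\<^bsub>?G\<^esub> y)"
  proof (rule smooth_map_submanifold)
    show "smooth_on UNIV (\<lambda>z. gq_mult l1 l2 l3 (fst z) (snd z))"
      by (intro smooth_on_bounded_bilinear[OF bil] smooth_on_linear linear_fst linear_snd open_UNIV)
    show "P \<subseteq> ?S \<times> ?S \<and> smooth_parametrization P \<rho>" if "(P, \<rho>) \<in> prod_atlas ?A ?A" for P \<rho>
      using submanifold_atlas_parametrization submanifold_atlas_parametrization that
      by (rule prod_atlas_parametrization)
  qed (auto simp: mult gq_sphere_closed)
  then have smooth_mult: "smooth_map (prod_topology (top_of_set ?S) (top_of_set ?S)) (prod_atlas ?A ?A)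
      (top_of_set ?S) ?A (\<lambda>(x, y). x \<otimes>\<^bsub>?G\<^esub> y)"
    by simp
  have smooth_inv: "smooth_map (top_of_set ?S) ?A (top_of_set ?S) ?A (\<lambda>x. inv\<^bsub>?G\<^esub> x)"
    by (rule smooth_map_submanifold[OF smooth_on_linear[OF linear_gq_conj]])
      (auto simp: inv_gq_sphere gq_sphere_closed dest: submanifold_atlas_parametrization)
  have "smooth_manifold (top_of_set ?S) ?A"
    by (rule smooth_manifold_submanifold_atlas[OF gq_sphere_slice_chart_exists])
  moreover have "topspace (top_of_set ?S) = carrier ?G" by (simp add: gq_sphere_monoid_def)
  ultimately show ?thesis
    using group_gq_sphere smooth_mult smooth_inv
    by (intro lie_group.intro lie_group_axioms.intro)
qed

end
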